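(* Let $H$ be a graph containing a cycle $C$ and three vertices none of which has a neighbor in $V(C)$. Then the class of $H$-subdivisions does not have the induced Erdős–Pósa property.
   Context: All graphs are finite and simple. A subdivision of $H$ is a graph obtained from $H$ by repeatedly replacing an edge by a path of length $2$ through a new vertex. An induced subdivision of $H$ in $G$ is an induced subgraph of $G$ isomorphic to a subdivision of $H$. The class of $H$-subdivisions has the induced Erdős–Pósa property if there is a function $f:\mathbb N\to\mathbb R$ such that for every graph $G$ and every positive integer $k$, $G$ contains either $k$ pairwise vertex-disjoint induced subdivisions of $H$ or a set of at most $f(k)$ vertices meeting every induced subdivision of $H$. *)

theory Defs
  imports Complex_Main
begin

type_synonym 'a graph = "'a set \<times> 'a set set"

definition verts :: "'a graph \<Rightarrow> 'a set" where "verts G = fst G"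
definition edges :: "'a graph \<Rightarrow> 'a set set" where "edges G = snd G"

definition graph :: "'a graph \<Rightarrow> bool" where
  "graph G \<longleftrightarrow> finite (verts G) \<and> (\<forall>e\<in>edges G. e \<subseteq> verts G \<and> card e = 2)"

definition adj :: "'a graph \<Rightarrow> 'a \<Rightarrow> 'a \<Rightarrow> bool" where
  "adj G u v \<longleftrightarrow> {u, v} \<in> edges G"

definition isomorphic :: "'b graph \<Rightarrow> 'a graph \<Rightarrow> bool" where
  "isomorphic H G \<longleftrightarrow> (\<exists>\<phi>. bij_betw \<phi> (verts H) (verts G) \<and>
      (\<forall>u\<in>verts H. \<forall>v\<in>verts H. adj H u v \<longleftrightarrow> adj G (\<phi> u) (\<phi> v)))"

inductive subdivision_of :: "'b graph \<Rightarrow> 'a graph \<Rightarrow> bool" for H where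
  base: "graph G \<Longrightarrow> isomorphic H G \<Longrightarrow> subdivision_of H G"
| step: "subdivision_of H G \<Longrightarrow> {u, v} \<in> edges G \<Longrightarrow> w \<notin> verts G \<Longrightarrow>
         subdivision_of H (insert w (verts G), (edges G - {{u, v}}) \<union> {{u, w}, {w, v}})"

definition induced :: "'a graph \<Rightarrow> 'a set \<Rightarrow> 'a graph" where
  "induced G X = (X, {e \<in> edges G. e \<subseteq> X})"

definition induced_subdiv :: "'b graph \<Rightarrow> 'a graph \<Rightarrow> 'a set \<Rightarrow> bool" where
  "induced_subdiv H G X \<longleftrightarrow> X \<subseteq> verts G \<and> subdivision_of H (induced G X)"

text \<open>Induced Erdos-Posa property for H-subdivisions. Host graphs are taken with
vertices in nat; every finite graph is isomorphic to one of these.\<close>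
definition induced_EP :: "'b graph \<Rightarrow> bool" where
  "induced_EP H \<longleftrightarrow> (\<exists>f :: nat \<Rightarrow> real. \<forall>(G :: nat graph) (k :: nat). graph G \<longrightarrow> k > 0 \<longrightarrow>
      (\<exists>Xs :: nat \<Rightarrow> nat set. (\<forall>i<k. induced_subdiv H G (Xs i)) \<and>
           (\<forall>i<k. \<forall>j<k. i \<noteq> j \<longrightarrow> Xs i \<inter> Xs j = {}))
    \<or> (\<exists>S. S \<subseteq> verts G \<and> real (card S) \<le> f k \<and>
           (\<forall>X. induced_subdiv H G X \<longrightarrow> X \<inter> S \<noteq> {})))"

definition is_cycle :: "'b graph \<Rightarrow> 'b list \<Rightarrow> bool" where
  "is_cycle H C \<longleftrightarrow> length C \<ge> 3 \<and> distinct C \<and> set C \<subseteq> verts H \<and>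
     (\<forall>i < length C. adj H (C ! i) (C ! ((i + 1) mod length C)))"

end

theory Submission
  imports Defs "HOL-Library.Nat_Bijection"
begin

text \<open>
  Let \<open>K\<close> be a subdivision of \<open>H\<close> of large girth with \<open>n\<close> independent vertices on one
  cycle. Take \<open>n\<close> copies (``lines'') of \<open>K\<close>, let any two of them share exactly one of these vertices,
  each vertex lying on at most two lines, and join any two vertices that share no line. Every line is
  an induced subdivision of \<open>H\<close>, so hitting all of them takes \<open>n / 2\<close> vertices.

  Conversely, let \<open>F\<close> be an induced subdivision of \<open>H\<close> in this graph. It contains a cycle and three
  vertices with no neighbour on it, so each vertex of the cycle shares a line with each of the three.
  As two lines share only one vertex, this forces the cycle into a single line. A vertex off that
  line is adjacent to all but two vertices of the cycle; large girth makes its degree too large for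
  \<open>F\<close>, so \<open>F\<close> lies in that line. The cycle spaces of \<open>F\<close>, \<open>H\<close> and \<open>K\<close> have the same size, so \<open>F\<close>
  contains all cycles of its line and in particular all vertices shared with other lines. Hence any two
  induced subdivisions of \<open>H\<close> meet.
\<close>

section \<open>The cycle space of a graph under subdivision\<close>

definition edeg :: "'a set set \<Rightarrow> 'a \<Rightarrow> nat" where
  "edeg S v = card {e \<in> S. v \<in> e}"

text \<open>The binary cycle space. Nonempty even edge sets stand in for cycles throughout: a
  subdivision carries them along by a bijection, and no paths or walks have to be handled.\<close>

definition cycle_space :: "'a graph \<Rightarrow> 'a set set set" where
  "cycle_space G = {S. S \<subseteq> edges G \<and> (\<forall>v. even (edeg S v))}"

definition map_graph :: "('a \<Rightarrow> 'b) \<Rightarrow> 'a graph \<Rightarrow> 'b graph" where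
  "map_graph f G = (f ` verts G, (`) f ` edges G)"

definition subdivide :: "'a graph \<Rightarrow> 'a \<Rightarrow> 'a \<Rightarrow> 'a \<Rightarrow> 'a graph" where
  "subdivide G u v w = (insert w (verts G), (edges G - {{u, v}}) \<union> {{u, w}, {w, v}})"

text \<open>Lifts an edge set of a graph to its subdivision. Applied to all edges it gives the edges
  of the new graph, on even sets it is the bijection of cycle spaces.\<close>

definition reroute :: "'a \<Rightarrow> 'a \<Rightarrow> 'a \<Rightarrow> 'a set set \<Rightarrow> 'a set set" where
  "reroute u v w S = (if {u, v} \<in> S then (S - {{u, v}}) \<union> {{u, w}, {w, v}} else S)"

section \<open>Finite simple graphs and injective renamings\<close>

lemma verts_edges_simps [simp]:
  "verts (V, E) = V" "edges (V, E) = E"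
  by (auto simp: verts_def edges_def)

lemma verts_map_graph [simp]: "verts (map_graph f G) = f ` verts G"
  and edges_map_graph [simp]: "edges (map_graph f G) = (`) f ` edges G"
  by (auto simp: map_graph_def)

lemma verts_subdivide [simp]: "verts (subdivide G u v w) = insert w (verts G)"
  by (simp add: subdivide_def)

lemma edges_subdivide:
  "{u, v} \<in> edges G \<Longrightarrow> edges (subdivide G u v w) = reroute u v w (edges G)"
  by (simp add: subdivide_def reroute_def)

lemma graph_edgeD:
  assumes "graph G" "{u, v} \<in> edges G"
  shows "u \<in> verts G" "v \<in> verts G" "u \<noteq> v"
  using assms unfolding graph_def by (force simp: card_2_iff doubleton_eq_iff)+

lemma graph_finite_edges: "graph G \<Longrightarrow> finite (edges G)"
  unfolding graph_def by (auto intro: finite_subset[of _ "Pow (verts G)"])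

lemma graph_edgeE:
  assumes "graph G" "e \<in> edges G"
  obtains u v where "e = {u, v}" "u \<noteq> v" "u \<in> verts G" "v \<in> verts G"
  using assms unfolding graph_def by (metis card_2_iff insert_subset)

lemma finite_cycle_space: "graph G \<Longrightarrow> finite (cycle_space G)"
  by (rule finite_subset[of _ "Pow (edges G)"]) (auto simp: cycle_space_def graph_finite_edges)

lemma graph_subdivide:
  assumes "graph G" "{u, v} \<in> edges G" "w \<notin> verts G"
  shows "graph (subdivide G u v w)"
  using assms graph_edgeD[OF assms(1,2)]
  by (auto simp: graph_def subdivide_def card_insert_if)

lemma graph_map_graph:
  assumes "graph G" "inj_on f (verts G)"
  shows "graph (map_graph f G)"
  unfolding graph_def
proof (intro conjI ballI)
  show "finite (verts (map_graph f G))" using assms by (auto simp: graph_def)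
  fix e assume "e \<in> edges (map_graph f G)"
  then obtain d where d: "d \<in> edges G" "e = f ` d" by auto
  have "d \<subseteq> verts G" "card d = 2" using d assms unfolding graph_def by auto
  thus "e \<subseteq> verts (map_graph f G)" "card e = 2"
    using d assms(2) by (auto simp: card_image inj_on_subset)
qed

text \<open>Adjacency determines \<open>G\<close> completely because each edge is a pair of
  vertices, so an isomorphic copy is literally a renaming. Inductions over subdivisions can then
  start from \<open>map_graph f H\<close>.\<close>

lemma isomorphic_imp_map_graph:
  assumes "graph H" "graph G" "isomorphic H G"
  obtains f where "inj_on f (verts H)" "G = map_graph f H"
proof -
  obtain f where bij: "bij_betw f (verts H) (verts G)"
    and ad: "\<forall>u\<in>verts H. \<forall>v\<in>verts H. adj H u v \<longleftrightarrow> adj G (f u) (f v)"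
    using assms(3) unfolding isomorphic_def by blast
  have V: "verts G = f ` verts H" using bij by (auto simp: bij_betw_def)
  have "edges G = (`) f ` edges H"
  proof
    show "edges G \<subseteq> (`) f ` edges H"
    proof
      fix e assume e: "e \<in> edges G"
      then obtain a b where ab: "e = {a, b}" "a \<in> verts G" "b \<in> verts G"
        using graph_edgeE[OF assms(2)] by metis
      then obtain u v where uv: "u \<in> verts H" "v \<in> verts H" "a = f u" "b = f v"
        using V by auto
      have "{u, v} \<in> edges H" using ad e ab uv unfolding adj_def by auto
      moreover have "e = f ` {u, v}" using ab uv by auto
      ultimately show "e \<in> (`) f ` edges H" by blast
    qed
    show "(`) f ` edges H \<subseteq> edges G"
    proof
      fix e assume "e \<in> (`) f ` edges H"
      then obtain d where d: "d \<in> edges H" "e = f ` d" by auto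
      then obtain u v where "d = {u, v}" "u \<in> verts H" "v \<in> verts H"
        using graph_edgeE[OF assms(1)] by metis
      thus "e \<in> edges G" using ad d unfolding adj_def by auto
    qed
  qed
  hence "G = map_graph f H" using V by (simp add: map_graph_def verts_def edges_def prod_eq_iff)
  thus thesis using that bij by (auto simp: bij_betw_def)
qed

lemma adj_map_graph:
  assumes "graph H" "inj_on f (verts H)" "u \<in> verts H" "v \<in> verts H"
  shows "adj (map_graph f H) (f u) (f v) \<longleftrightarrow> adj H u v"
proof -
  have "{u, v} \<in> edges H" if "f ` {u, v} = f ` e" "e \<in> edges H" for e
  proof -
    have "e \<subseteq> verts H" using that assms(1) by (auto simp: graph_def)
    hence "{u, v} = e"
      using that(1) assms(2-4) by (metis inj_on_image_eq_iff empty_subsetI insert_subset)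
    thus ?thesis using that by simp
  qed
  thus ?thesis
    unfolding adj_def by (auto simp: image_iff) (metis image_empty image_insert)
qed

lemma isomorphic_map_graph:
  assumes "graph H" "inj_on f (verts H)"
  shows "isomorphic H (map_graph f H)"
  unfolding isomorphic_def using assms adj_map_graph[OF assms]
  by (intro exI[of _ f]) (auto simp: bij_betw_def)

lemma edeg_image:
  assumes inj: "inj_on f V" and S: "\<And>e. e \<in> S \<Longrightarrow> e \<subseteq> V"
  shows "edeg ((`) f ` S) a = (if a \<in> f ` V then edeg S (inv_into V f a) else 0)"
proof (cases "a \<in> f ` V")
  case True
  then obtain v where v: "v \<in> V" "a = f v" by auto
  have iv: "inv_into V f a = v" using v inj by simp
  have "{e \<in> (`) f ` S. a \<in> e} = (`) f ` {e \<in> S. v \<in> e}"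
    using v inj S by (auto dest: inj_onD)
  moreover have "inj_on ((`) f) {e \<in> S. v \<in> e}"
    using inj S by (intro inj_onI) (metis (no_types, lifting) inj_on_image_eq_iff mem_Collect_eq)
  ultimately show ?thesis using True iv by (simp add: edeg_def card_image)
next
  case False
  have "{e \<in> (`) f ` S. a \<in> e} = {}" using False S by auto
  thus ?thesis using False by (simp add: edeg_def del: Collect_empty_eq)
qed

lemma cycle_space_map_graph:
  assumes "graph G" "inj_on f (verts G)"
  shows "cycle_space (map_graph f G) = (`) ((`) f) ` cycle_space G"
proof -
  have E: "\<And>e. e \<in> edges G \<Longrightarrow> e \<subseteq> verts G" using assms(1) by (auto simp: graph_def)
  have ev: "(\<forall>a. even (edeg ((`) f ` S) a)) \<longleftrightarrow> (\<forall>v. even (edeg S v))" if "S \<subseteq> edges G" for S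
  proof -
    have S: "\<And>e. e \<in> S \<Longrightarrow> e \<subseteq> verts G" using that E by auto
    have out: "edeg S v = 0" if "v \<notin> verts G" for v
    proof -
      have "{e \<in> S. v \<in> e} = {}" using S that by auto
      thus ?thesis by (simp add: edeg_def del: Collect_empty_eq)
    qed
    have "even (edeg S v)" if "\<forall>a. even (edeg ((`) f ` S) a)" for v
    proof (cases "v \<in> verts G")
      case True
      thus ?thesis using spec[OF that, of "f v"] edeg_image[where S = S and a = "f v", OF assms(2) S] assms(2)
        by simp
    qed (simp add: out)
    thus ?thesis using edeg_image[where S = S, OF assms(2) S] by auto
  qed
  show ?thesis
  proof
    show "cycle_space (map_graph f G) \<subseteq> (`) ((`) f) ` cycle_space G"
    proof
      fix T assume T: "T \<in> cycle_space (map_graph f G)"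
      then obtain S where "S \<subseteq> edges G" "T = (`) f ` S"
        by (auto simp: cycle_space_def subset_image_iff)
      thus "T \<in> (`) ((`) f) ` cycle_space G" using T ev by (auto simp: cycle_space_def)
    qed
    show "(`) ((`) f) ` cycle_space G \<subseteq> cycle_space (map_graph f G)"
      using ev by (auto simp: cycle_space_def)
  qed
qed

lemma inj_on_image_image:
  assumes "graph G" "inj_on f (verts G)"
  shows "inj_on ((`) f) (edges G)" "inj_on ((`) ((`) f)) (cycle_space G)"
proof -
  show 1: "inj_on ((`) f) (edges G)"
    using assms by (intro inj_onI) (metis graph_def inj_on_image_eq_iff)
  show "inj_on ((`) ((`) f)) (cycle_space G)"
    using 1 by (intro inj_onI) (metis (no_types, lifting) cycle_space_def inj_on_image_eq_iff mem_Collect_eq)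
qed

lemma card_cycle_space_map_graph:
  assumes "graph G" "inj_on f (verts G)"
  shows "card (cycle_space (map_graph f G)) = card (cycle_space G)"
  using assms by (simp add: cycle_space_map_graph card_image inj_on_image_image)

section \<open>Even edge sets under the subdivision of one edge\<close>

lemma edeg_reroute:
  assumes "finite S" "\<And>e. e \<in> S \<Longrightarrow> w \<notin> e" "u \<noteq> v" "u \<noteq> w" "v \<noteq> w"
  shows "edeg (reroute u v w S) a =
    (if a = w then (if {u, v} \<in> S then 2 else 0) else edeg S a)"
proof (cases "{u, v} \<in> S")
  case False
  have "{e \<in> S. w \<in> e} = {}" using assms(2) by auto
  hence "edeg S w = 0" by (simp add: edeg_def del: Collect_empty_eq)
  thus ?thesis using False by (simp add: reroute_def)
next
  case True
  let ?A = "{e \<in> S. a \<in> e}"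
  have uw: "{u, w} \<notin> S" "{w, v} \<notin> S" "{u, w} \<noteq> {w, v}" using assms by (auto simp: doubleton_eq_iff)
  \<comment> \<open>An end of the old edge trades \<open>{u, v}\<close> for one new edge, so its
    degree stays; only \<open>w\<close> gains, namely two edges.\<close>
  consider "a = w" | "a = u" | "a = v" | "a \<noteq> w" "a \<noteq> u" "a \<noteq> v" by blast
  thus ?thesis
  proof cases
    case 1
    have "{e \<in> reroute u v w S. w \<in> e} = {{u, w}, {w, v}}"
      using True assms by (auto simp: reroute_def)
    thus ?thesis using 1 True uw by (simp add: edeg_def)
  next
    case 2
    have "{e \<in> reroute u v w S. u \<in> e} = insert {u, w} (?A - {{u, v}})"
      using True assms 2 by (auto simp: reroute_def)
    moreover have "card (insert {u, w} (?A - {{u, v}})) = card ?A"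
    proof -
      have "{u, v} \<in> ?A" "finite ?A" "{u, w} \<notin> ?A - {{u, v}}" using True uw assms(1) 2 by auto
      thus ?thesis using card_insert_disjoint[of "?A - {{u, v}}"] card_Suc_Diff1[of ?A "{u, v}"] by simp
    qed
    ultimately show ?thesis using 2 assms by (simp add: edeg_def)
  next
    case 3
    have "{e \<in> reroute u v w S. v \<in> e} = insert {w, v} (?A - {{u, v}})"
      using True assms 3 by (auto simp: reroute_def)
    moreover have "card (insert {w, v} (?A - {{u, v}})) = card ?A"
    proof -
      have "{u, v} \<in> ?A" "finite ?A" "{w, v} \<notin> ?A - {{u, v}}" using True uw assms(1) 3 by auto
      thus ?thesis using card_insert_disjoint[of "?A - {{u, v}}"] card_Suc_Diff1[of ?A "{u, v}"] by simp
    qed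
    ultimately show ?thesis using 3 assms by (simp add: edeg_def)
  next
    case 4
    have "{e \<in> reroute u v w S. a \<in> e} = ?A" using True 4 by (auto simp: reroute_def)
    thus ?thesis using 4 by (simp add: edeg_def)
  qed
qed

lemma card_reroute:
  assumes "finite S" "\<And>e. e \<in> S \<Longrightarrow> w \<notin> e" "u \<noteq> v"
  shows "card (reroute u v w S) = card S + (if {u, v} \<in> S then 1 else 0)"
proof (cases "{u, v} \<in> S")
  case True
  have uw: "{u, w} \<notin> S" "{w, v} \<notin> S" "{u, w} \<noteq> {w, v}" using assms by (auto simp: doubleton_eq_iff)
  have "reroute u v w S = insert {u, w} (insert {w, v} (S - {{u, v}}))"
    using True by (auto simp: reroute_def)
  hence "card (reroute u v w S) = Suc (Suc (card (S - {{u, v}})))"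
    using uw assms(1) by simp
  thus ?thesis using True assms(1) by (metis add.commute card_Suc_Diff1 plus_1_eq_Suc)
qed (simp add: reroute_def)

locale edge_subdivision =
  fixes G :: "'a graph" and u v w :: 'a
  assumes graph: "graph G" and edge: "{u, v} \<in> edges G" and fresh: "w \<notin> verts G"
begin

lemma distinct_ends: "u \<noteq> v" "u \<noteq> w" "v \<noteq> w"
  using graph_edgeD[OF graph edge] fresh by auto

lemma fresh_edges: "e \<in> edges G \<Longrightarrow> w \<notin> e"
  using graph fresh by (auto simp: graph_def)

lemma fresh_cycle_space: "S \<in> cycle_space G \<Longrightarrow> e \<in> S \<Longrightarrow> w \<notin> e"
  using fresh_edges by (auto simp: cycle_space_def)

lemma finite_in_cycle_space: "S \<in> cycle_space G \<Longrightarrow> finite S"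
  using graph_finite_edges[OF graph] by (auto simp: cycle_space_def intro: finite_subset)

lemma reroute_in_cycle_space:
  assumes "S \<in> cycle_space G"
  shows "reroute u v w S \<in> cycle_space (subdivide G u v w)"
proof -
  have "edeg (reroute u v w S) a = (if a = w then (if {u, v} \<in> S then 2 else 0) else edeg S a)" for a
    using assms fresh_cycle_space finite_in_cycle_space distinct_ends by (intro edeg_reroute) auto
  moreover have "reroute u v w S \<subseteq> edges (subdivide G u v w)"
    using assms by (auto simp: reroute_def subdivide_def cycle_space_def)
  ultimately show ?thesis using assms by (simp add: cycle_space_def)
qed

text \<open>The inverse removes the edges at \<open>w\<close> and restores \<open>{u, v}\<close> if
  \<open>{u, w}\<close> was present. It works on all of the new cycle space because \<open>w\<close>
  has only two edges, so an even set contains both or neither.\<close>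

lemma bij_betw_reroute:
  "bij_betw (reroute u v w) (cycle_space G) (cycle_space (subdivide G u v w))"
  unfolding bij_betw_def
proof
  have inv: "S = {e \<in> reroute u v w S. w \<notin> e} \<union> (if {u, w} \<in> reroute u v w S then {{u, v}} else {})"
    if "S \<in> cycle_space G" for S
    using fresh_cycle_space[OF that] distinct_ends by (auto simp: reroute_def split: if_splits)
  show "inj_on (reroute u v w) (cycle_space G)"
  proof (rule inj_onI)
    fix S T assume S: "S \<in> cycle_space G" and T: "T \<in> cycle_space G"
      and eq: "reroute u v w S = reroute u v w T"
    show "S = T" using inv[OF S] inv[OF T] unfolding eq by (rule trans[OF _ sym])
  qed
  show "reroute u v w ` cycle_space G = cycle_space (subdivide G u v w)"
  proof
    show "reroute u v w ` cycle_space G \<subseteq> cycle_space (subdivide G u v w)"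
      using reroute_in_cycle_space by auto
    show "cycle_space (subdivide G u v w) \<subseteq> reroute u v w ` cycle_space G"
    proof
      fix T assume T: "T \<in> cycle_space (subdivide G u v w)"
      define S where "S = {e \<in> T. w \<notin> e} \<union> (if {u, w} \<in> T then {{u, v}} else {})"
      have TE: "T \<subseteq> (edges G - {{u, v}}) \<union> {{u, w}, {w, v}}"
        using T by (auto simp: cycle_space_def subdivide_def)
      have SE: "S \<subseteq> edges G" using TE edge by (auto simp: S_def split: if_splits)
      have both: "{u, w} \<in> T \<longleftrightarrow> {w, v} \<in> T"
      proof (rule ccontr)
        assume "\<not> ?thesis"
        hence "{e \<in> T. w \<in> e} = {{u, w}} \<or> {e \<in> T. w \<in> e} = {{w, v}}"
          using TE fresh_edges by auto
        hence "edeg T w = 1" unfolding edeg_def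
          by (elim disjE) (simp_all only: is_singletonI is_singleton_altdef[symmetric])
        moreover have "even (edeg T w)" using T by (simp add: cycle_space_def)
        ultimately show False by simp
      qed
      have uvS: "{u, v} \<in> S \<longleftrightarrow> {u, w} \<in> T" using TE distinct_ends by (auto simp: S_def)
      have eq: "reroute u v w S = T"
      proof (cases "{u, w} \<in> T")
        case True
        have "{u, v} \<notin> T" using TE distinct_ends by (auto simp: doubleton_eq_iff)
        hence "S - {{u, v}} = {e \<in> T. w \<notin> e}" using True by (auto simp: S_def)
        moreover have "T = {e \<in> T. w \<notin> e} \<union> {{u, w}, {w, v}}"
          using TE fresh_edges True both by auto
        ultimately show ?thesis using True uvS by (simp add: reroute_def)
      next
        case False
        have "T = {e \<in> T. w \<notin> e}" using TE fresh_edges False both by auto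
        thus ?thesis using False uvS by (simp add: reroute_def S_def)
      qed
      have fin: "finite S" using SE graph_finite_edges[OF graph] finite_subset by blast
      have nw: "\<And>e. e \<in> S \<Longrightarrow> w \<notin> e" using SE fresh_edges by auto
      have "even (edeg S a)" for a
      proof (cases "a = w")
        case True
        have "{e \<in> S. w \<in> e} = {}" using nw by auto
        thus ?thesis using True by (simp add: edeg_def del: Collect_empty_eq)
      next
        case False
        have "edeg T a = edeg S a"
          using edeg_reroute[of S w u v a] fin nw distinct_ends False eq by auto
        moreover have "even (edeg T a)" using T by (simp add: cycle_space_def)
        ultimately show ?thesis by simp
      qed
      hence "S \<in> cycle_space G" using SE by (auto simp: cycle_space_def)
      thus "T \<in> reroute u v w ` cycle_space G" using eq by blast
    qed
  qed
qed

lemma card_cycle_space_subdivide: "card (cycle_space (subdivide G u v w)) = card (cycle_space G)"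
  using bij_betw_reroute bij_betw_same_card by metis

lemma card_reroute_cycle_space:
  "S \<in> cycle_space G \<Longrightarrow> card (reroute u v w S) = card S + (if {u, v} \<in> S then 1 else 0)"
  using fresh_cycle_space finite_in_cycle_space distinct_ends by (intro card_reroute) auto

lemma edeg_edges_subdivide:
  "edeg (edges (subdivide G u v w)) a = (if a = w then 2 else edeg (edges G) a)"
  using edeg_reroute[of "edges G" w u v a] graph_finite_edges[OF graph] fresh_edges distinct_ends edge
  by (simp add: edges_subdivide)

lemma adj_subdivide_old:
  "a \<noteq> w \<Longrightarrow> b \<noteq> w \<Longrightarrow> adj (subdivide G u v w) a b \<Longrightarrow> adj G a b"
  by (auto simp: adj_def subdivide_def doubleton_eq_iff)

lemma Union_reroute: "\<Union>S \<subseteq> \<Union>(reroute u v w S)"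
  by (auto simp: reroute_def)

end

section \<open>Induction over repeated subdivision\<close>

lemma subdivision_of_subdivide:
  assumes "subdivision_of H G" "{u, v} \<in> edges G" "w \<notin> verts G"
  shows "subdivision_of H (subdivide G u v w)"
  unfolding subdivide_def using assms by (rule subdivision_of.step)

text \<open>The rule carries \<open>graph G\<close> along, so that each step supplies the locale
  \<open>edge_subdivision\<close>, and replaces isomorphism in the base case by renaming.\<close>

lemma subdivision_of_induct [consumes 2, case_names base step]:
  assumes "subdivision_of H G" "graph H"
    and base: "\<And>f. inj_on f (verts H) \<Longrightarrow> P (map_graph f H)"
    and step: "\<And>G u v w. subdivision_of H G \<Longrightarrow> P G \<Longrightarrow> edge_subdivision G u v w \<Longrightarrow>
      P (subdivide G u v w)"
  shows "P G"
proof -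
  have "graph G \<and> P G" using assms(1)
  proof induction
    case (base G)
    thus ?case using isomorphic_imp_map_graph[OF assms(2)] assms(3) by metis
  next
    case (step G u v w)
    hence "edge_subdivision G u v w" by (simp add: edge_subdivision_def)
    thus ?case using step assms(4) graph_subdivide[of G u v w] by (simp add: subdivide_def)
  qed
  thus ?thesis ..
qed

lemma subdivision_of_graph:
  assumes "subdivision_of H G" "graph H"
  shows "graph G"
  using assms by (induction rule: subdivision_of_induct)
    (auto intro: graph_map_graph[OF assms(2)] graph_subdivide simp: edge_subdivision_def)

text \<open>This invariant later forces a subdivision of \<open>H\<close> inside a copy of
  \<open>K\<close> to contain all cycles of that copy.\<close>

lemma card_cycle_space_subdivision_of:
  assumes "subdivision_of H G" "graph H"
  shows "card (cycle_space G) = card (cycle_space H)"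
  using assms by (induction rule: subdivision_of_induct)
    (auto simp: card_cycle_space_map_graph[OF assms(2)] edge_subdivision.card_cycle_space_subdivide)

text \<open>Renaming commutes with subdividing an edge, and injectivity keeps the new vertex new. It
  serves for the lines, which are renamed copies of \<open>K\<close>.\<close>

lemma subdivision_of_map_graph:
  assumes "subdivision_of H G" "graph H" "inj_on f (verts G)"
  shows "subdivision_of H (map_graph f G)"
  using assms
proof (induction rule: subdivision_of_induct)
  case (base g)
  have eq: "map_graph f (map_graph g H) = map_graph (f \<circ> g) H"
    by (simp add: map_graph_def image_comp comp_def)
  have "inj_on (f \<circ> g) (verts H)" using base by (simp add: comp_inj_on)
  thus ?case unfolding eq
    by (intro subdivision_of.base graph_map_graph isomorphic_map_graph assms(2))
next
  case (step G u v w)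
  interpret edge_subdivision G u v w by fact
  have inj: "inj_on f (insert w (verts G))" using step by simp
  have injE: "inj_on ((`) f) (edges G)"
    using inj_on_image_image(1)[OF graph] inj by (meson inj_on_insert)
  have "map_graph f (subdivide G u v w) = subdivide (map_graph f G) (f u) (f v) (f w)"
    using inj_on_image_set_diff[OF injE, of "edges G" "{{u, v}}"] edge
    by (simp add: map_graph_def subdivide_def)
  moreover have "f w \<notin> verts (map_graph f G)" using inj fresh by auto
  moreover have "{f u, f v} \<in> edges (map_graph f G)" 
    using imageI[OF edge, of "(`) f"] by simp
  ultimately show ?case
    using step.IH inj by (metis inj_on_insert subdivision_of_subdivide)
qed

text \<open>Subdividing leaves old degrees alone and gives the new vertex degree 2, whence the
  condition \<open>2 \<le> d\<close>.\<close>

lemma edeg_subdivision_of_le: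
  assumes "subdivision_of H G" "graph H" "\<And>v. edeg (edges H) v \<le> d" "2 \<le> d"
  shows "edeg (edges G) a \<le> d"
  using assms(1,2)
proof (induction arbitrary: a rule: subdivision_of_induct)
  case (base f)
  have "\<And>e. e \<in> edges H \<Longrightarrow> e \<subseteq> verts H" using assms(2) by (auto simp: graph_def)
  thus ?case using edeg_image[OF base, of "edges H"] assms(3) by simp
next
  case (step G u v w)
  thus ?case using assms(4) by (simp add: edge_subdivision.edeg_edges_subdivide)
qed


section \<open>Subdivisions with prescribed features\<close>

definition remote :: "'a graph \<Rightarrow> 'a set set \<Rightarrow> 'a \<Rightarrow> bool" where
  "remote G S x \<longleftrightarrow> x \<in> verts G \<and> x \<notin> \<Union>S \<and> (\<forall>c\<in>\<Union>S. \<not> adj G x c)"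

text \<open>The even set is rerouted and the remote vertices are kept. If \<open>w\<close> becomes
  covered, then its only neighbours \<open>u\<close> and \<open>v\<close> were covered before, so no
  remote vertex is adjacent to \<open>w\<close>; between old vertices no edge is created.\<close>

lemma subdivision_of_remote:
  assumes "subdivision_of H G" "graph H"
    and S: "S \<in> cycle_space H" "S \<noteq> {}" and R: "\<forall>x\<in>R. remote H S x"
  shows "\<exists>T Q. T \<in> cycle_space G \<and> T \<noteq> {} \<and> card Q = card R \<and> (\<forall>x\<in>Q. remote G T x)"
  using assms(1,2)
proof (induction rule: subdivision_of_induct)
  case (base f)
  have SV: "e \<subseteq> verts H" if "e \<in> S" for e
    using that S assms(2) by (auto simp: graph_def cycle_space_def)
  have RV: "R \<subseteq> verts H" using R by (auto simp: remote_def)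
  have "(`) f ` S \<in> cycle_space (map_graph f H)" "(`) f ` S \<noteq> {}"
    using S cycle_space_map_graph[OF assms(2) base] by auto
  moreover have "card (f ` R) = card R"
    using RV base by (meson card_image inj_on_subset)
  moreover have "remote (map_graph f H) ((`) f ` S) (f x)" if "x \<in> R" for x
  proof -
    have iso: "adj (map_graph f H) (f x) (f c) \<longleftrightarrow> adj H x c" if "c \<in> verts H" for c
      using adj_map_graph[OF assms(2) base] RV \<open>x \<in> R\<close> that by blast
    have "f x \<notin> f ` e" if "e \<in> S" for e
      using that SV RV \<open>x \<in> R\<close> R base unfolding remote_def
      by (metis UnionI inj_on_image_mem_iff subsetD)
    moreover have "\<not> adj (map_graph f H) (f x) (f c)" if "e \<in> S" "c \<in> e" for e c
      using iso SV that R \<open>x \<in> R\<close> unfolding remote_def by blast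
    ultimately show ?thesis using RV that by (auto simp: remote_def)
  qed
  ultimately show ?case by (intro exI[of _ "(`) f ` S"] exI[of _ "f ` R"]) simp
next
  case (step G u v w)
  interpret edge_subdivision G u v w by fact
  obtain T Q where T: "T \<in> cycle_space G" "T \<noteq> {}" "card Q = card R" "\<forall>x\<in>Q. remote G T x"
    using step.IH by blast
  have "remote (subdivide G u v w) (reroute u v w T) x" if "x \<in> Q" for x
  proof -
    have x: "x \<in> verts G" "x \<notin> \<Union>T" "\<forall>c\<in>\<Union>T. \<not> adj G x c" using T(4) that by (auto simp: remote_def)
    have xw: "x \<noteq> w" using x(1) fresh by auto
    have sub: "\<Union>(reroute u v w T) \<subseteq> (if {u, v} \<in> T then insert w (\<Union>T) else \<Union>T)"
      by (auto simp: reroute_def)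
    have wT: "w \<notin> \<Union>T" using fresh_cycle_space[OF T(1)] by auto
    have "\<not> adj (subdivide G u v w) x c" if c: "c \<in> \<Union>(reroute u v w T)" for c
    proof (cases "c = w")
      case True
      hence "{u, v} \<in> T" using c sub wT by (auto split: if_splits)
      hence "x \<noteq> u" "x \<noteq> v" using x(2) by auto
      thus ?thesis using True xw fresh_edges
        by (auto simp: adj_def subdivide_def doubleton_eq_iff)
    next
      case False
      hence "c \<in> \<Union>T" using c sub by (auto split: if_splits)
      thus ?thesis using adj_subdivide_old[OF xw False] x(3) by blast
    qed
    thus ?thesis using x xw sub by (auto simp: remote_def split: if_splits)
  qed
  moreover have "reroute u v w T \<noteq> {}" using T(2) by (auto simp: reroute_def)
  ultimately show ?case using reroute_in_cycle_space[OF T(1)] T(3) by blast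
qed

section \<open>Cycles as even edge sets, girth, and independent vertices\<close>

lemma is_cycle_cycle_space:
  assumes "is_cycle H C"
  shows "\<exists>S \<in> cycle_space H. S \<noteq> {} \<and> \<Union>S = set C"
proof -
  define m where "m = length C"
  define s where "s i = (if Suc i = m then 0 else Suc i)" for i
  define E where "E i = {C ! i, C ! s i}" for i
  have m: "3 \<le> m" and dist: "distinct C" using assms by (auto simp: is_cycle_def m_def)
  have smod: "(i + 1) mod length C = s i" if "i < m" for i
    using that by (auto simp: s_def m_def mod_if)
  have slt: "s i < m" if "i < m" for i using that m by (auto simp: s_def)
  have nth: "C ! i = C ! j \<longleftrightarrow> i = j" if "i < m" "j < m" for i j
    using dist that by (simp add: nth_eq_iff_index_eq m_def)
  have sub: "E ` {..<m} \<subseteq> edges H"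
    using assms smod by (auto simp: is_cycle_def m_def adj_def E_def)
  have "even (edeg (E ` {..<m}) a)" for a
  proof (cases "a \<in> set C")
    case False
    have "{e \<in> E ` {..<m}. a \<in> e} = {}" using False slt by (auto simp: E_def m_def)
    thus ?thesis by (simp add: edeg_def del: Collect_empty_eq)
  next
    case True
    then obtain k where k: "k < m" "a = C ! k" by (metis in_set_conv_nth m_def)
    \<comment> \<open>\<open>l\<close> is the cyclic predecessor of \<open>k\<close>. The edges at
      \<open>C ! k\<close> are \<open>E k\<close> and \<open>E l\<close>, and these differ because
      the cycle has at least three vertices.\<close>
    define l where "l = (if k = 0 then m - 1 else k - 1)"
    have l: "l < m" "s l = k" "l \<noteq> k" "s k \<noteq> l" using k m by (auto simp: l_def s_def)
    have "i = k \<or> i = l" if "i < m" "a \<in> E i" for i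
    proof -
      have "k = i \<or> k = s i" using that k nth slt by (auto simp: E_def)
      thus ?thesis using that(1) k m by (auto simp: s_def l_def split: if_splits)
    qed
    moreover have "a \<in> E k" "a \<in> E l" using k l by (auto simp: E_def)
    ultimately have "{e \<in> E ` {..<m}. a \<in> e} = {E k, E l}" using k l by auto
    moreover have "E k \<noteq> E l" using nth k l slt by (auto simp: E_def doubleton_eq_iff)
    ultimately show ?thesis by (simp add: edeg_def)
  qed
  moreover have "\<Union>(E ` {..<m}) = set C"
    using slt by (auto simp: E_def m_def set_conv_nth)
  moreover have "E ` {..<m} \<noteq> {}" using m by (auto simp: lessThan_empty_iff)
  ultimately show ?thesis using sub
    by (intro bexI[of _ "E ` {..<m}"]) (simp_all add: cycle_space_def)
qed

text \<open>In a finite graph every nonempty even edge set contains the edges of a cycle, so this is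
  the usual lower bound on the girth.\<close>

definition girth_ge :: "nat \<Rightarrow> 'a graph \<Rightarrow> bool" where
  "girth_ge g G \<longleftrightarrow> (\<forall>S \<in> cycle_space G. S \<noteq> {} \<longrightarrow> g \<le> card S)"

lemma (in edge_subdivision) girth_ge_subdivide:
  assumes "girth_ge g G"
  shows "girth_ge g (subdivide G u v w)"
  unfolding girth_ge_def
proof (intro ballI impI)
  fix T assume "T \<in> cycle_space (subdivide G u v w)" "T \<noteq> {}"
  then obtain S where S: "S \<in> cycle_space G" "T = reroute u v w S"
    using bij_betw_reroute by (auto simp: bij_betw_def)
  hence "S \<noteq> {}" using \<open>T \<noteq> {}\<close> by (auto simp: reroute_def)
  thus "g \<le> card T" using S assms card_reroute_cycle_space by (auto simp: girth_ge_def)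
qed

text \<open>Subdividing an edge of a short even edge set decreases the total defect of \<open>cycle_space\<close>.\<close>
lemma ex_subdivision_girth_ge:
  fixes G :: "nat graph"
  assumes "subdivision_of H G" "graph H"
  shows "\<exists>K :: nat graph. subdivision_of H K \<and> girth_ge g K"
  using assms(1)
proof (induction "\<Sum>S\<in>cycle_space G - {{}}. g - card S" arbitrary: G rule: less_induct)
  case less
  show ?case
  proof (cases "girth_ge g G")
    case False
    then obtain S where S: "S \<in> cycle_space G" "S \<noteq> {}" "card S < g"
      unfolding girth_ge_def not_le[symmetric] by blast
    have gr: "graph G" using subdivision_of_graph less.prems assms(2) by blast
    obtain e where e: "e \<in> S" using S by blast
    have "e \<in> edges G" using e S by (auto simp: cycle_space_def)
    then obtain u v where uv: "e = {u, v}"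
      using graph_edgeE[OF gr] by metis
    obtain w where w: "w \<notin> verts G"
      using gr unfolding graph_def using ex_new_if_finite infinite_UNIV_nat by blast
    interpret edge_subdivision G u v w
      using gr w e uv S by unfold_locales (auto simp: cycle_space_def)
    let ?G = "subdivide G u v w"
    have "bij_betw (reroute u v w) (cycle_space G - {{}}) (cycle_space ?G - {{}})"
    proof -
      have "reroute u v w {} = {}" by (simp add: reroute_def)
      moreover have "{} \<in> cycle_space G" by (simp add: cycle_space_def edeg_def)
      ultimately have "{} \<in> cycle_space ?G" using reroute_in_cycle_space by metis
      thus ?thesis using bij_betw_DiffI[OF bij_betw_reroute, of "{{}}" "{{}}"]
        \<open>reroute u v w {} = {}\<close> \<open>{} \<in> cycle_space G\<close> by (simp add: bij_betw_def)
    qed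
    hence "(\<Sum>T\<in>cycle_space ?G - {{}}. g - card T)
        = (\<Sum>T\<in>cycle_space G - {{}}. g - card (reroute u v w T))"
      by (rule sum.reindex_bij_betw[symmetric])
    also have "\<dots> < (\<Sum>T\<in>cycle_space G - {{}}. g - card T)"
    proof (rule sum_strict_mono_ex1)
      show "finite (cycle_space G - {{}})" using finite_cycle_space[OF gr] by simp
      show "\<forall>T\<in>cycle_space G - {{}}. g - card (reroute u v w T) \<le> g - card T"
        using card_reroute_cycle_space by auto
      \<comment> \<open>With \<open>card S < g\<close> and the subdivided edge in \<open>S\<close>,
        the term of \<open>S\<close> drops by one; truncated subtraction lets no term rise.\<close>
      show "\<exists>T\<in>cycle_space G - {{}}. g - card (reroute u v w T) < g - card T"
        using S e uv card_reroute_cycle_space by (intro bexI[of _ S]) auto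
    qed
    finally show ?thesis
      using less.hyps subdivision_of_subdivide[OF less.prems edge fresh] by blast
  qed (use less.prems in blast)
qed

text \<open>Describes the vertices prepared for gluing. They are covered by one even edge set, so a
  subgraph that contains every even set of a copy contains all of them.\<close>

definition spread :: "'a graph \<Rightarrow> 'a set set \<Rightarrow> 'a set \<Rightarrow> bool" where
  "spread G S W \<longleftrightarrow> S \<in> cycle_space G \<and> S \<noteq> {} \<and> W \<subseteq> \<Union>S \<and> (\<forall>a\<in>W. \<forall>b\<in>W. \<not> adj G a b)"

lemma (in edge_subdivision) spread_subdivide:
  assumes "spread G S W"
  shows "spread (subdivide G u v w) (reroute u v w S) W"
proof -
  have "w \<notin> W" using assms fresh_cycle_space unfolding spread_def by blast
  hence "\<not> adj (subdivide G u v w) a b" if "a \<in> W" "b \<in> W" for a b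
    using that assms adj_subdivide_old[of a b] unfolding spread_def by blast
  moreover have "reroute u v w S \<noteq> {}" using assms by (auto simp: spread_def reroute_def)
  ultimately show ?thesis
    using assms reroute_in_cycle_space Union_reroute[of S] unfolding spread_def by blast
qed

text \<open>In the induction step three subdivisions replace an edge \<open>{u, v}\<close> of the
  even set by a path \<open>u\<close>, \<open>b\<close>, \<open>a\<close>, \<open>c\<close>,
  \<open>v\<close>. The new member \<open>a\<close> of \<open>W\<close> is adjacent only to
  \<open>b\<close> and \<open>c\<close>, which are new and outside \<open>W\<close>, so independence
  persists.\<close>

lemma ex_subdivision_spread:
  fixes G :: "nat graph"
  assumes "subdivision_of H G" "graph H" "girth_ge g G" "S \<in> cycle_space G" "S \<noteq> {}"
  shows "\<exists>(K :: nat graph) T W. subdivision_of H K \<and> girth_ge g K \<and> spread K T W \<and> finite W \<and> card W = n"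
proof (induction n)
  case 0
  have "spread G S {}" using assms by (simp add: spread_def)
  thus ?case using assms by (metis card.empty finite.emptyI)
next
  case (Suc n)
  then obtain K :: "nat graph" and T W where K: "subdivision_of H K" "girth_ge g K"
    and sp: "spread K T W" and W: "finite W" "card W = n" by blast
  have gr: "graph K" using subdivision_of_graph K(1) assms(2) by blast
  obtain e where e: "e \<in> T" using sp by (auto simp: spread_def)
  moreover have "e \<in> edges K" using e sp by (auto simp: cycle_space_def spread_def)
  ultimately obtain u v where uv: "{u, v} \<in> T" "u \<noteq> v"
    using graph_edgeE[OF gr] by metis
  have uvE: "{u, v} \<in> edges K" using uv sp by (auto simp: spread_def cycle_space_def)
  have fin: "finite (verts K)" using gr by (simp add: graph_def)
  obtain a where a: "a \<notin> verts K" using fin ex_new_if_finite infinite_UNIV_nat by blast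
  obtain b where b: "b \<notin> insert a (verts K)"
    using fin ex_new_if_finite[of "insert a (verts K)"] infinite_UNIV_nat by auto
  obtain c where c: "c \<notin> insert b (insert a (verts K))"
    using fin ex_new_if_finite[of "insert b (insert a (verts K))"] infinite_UNIV_nat by auto
  note V = graph_edgeD[OF gr uvE]
  interpret s1: edge_subdivision K u v a by unfold_locales fact+
  define K1 where "K1 = subdivide K u v a"
  have "graph K1" "{u, a} \<in> edges K1" "b \<notin> verts K1"
    using graph_subdivide[OF gr uvE a] b by (auto simp: K1_def subdivide_def)
  then interpret s2: edge_subdivision K1 u a b by unfold_locales
  define K2 where "K2 = subdivide K1 u a b"
  have "graph K2" "{a, v} \<in> edges K2" "c \<notin> verts K2"
    using graph_subdivide[OF s2.graph s2.edge s2.fresh] b c V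
    by (auto simp: K1_def K2_def subdivide_def doubleton_eq_iff)
  then interpret s3: edge_subdivision K2 a v c by unfold_locales
  define K3 where "K3 = subdivide K2 a v c"
  define T1 where "T1 = reroute u v a T"
  define T2 where "T2 = reroute u a b T1"
  define T3 where "T3 = reroute a v c T2"
  have sub: "subdivision_of H K3"
    unfolding K3_def K2_def K1_def
    using K(1) s1.edge s1.fresh s2.edge s2.fresh s3.edge s3.fresh
    by (intro subdivision_of_subdivide) (simp_all add: K1_def K2_def)
  have girth: "girth_ge g K3"
    unfolding K3_def K2_def K1_def
    by (metis K(2) K1_def K2_def s1.girth_ge_subdivide s2.girth_ge_subdivide s3.girth_ge_subdivide)
  have sp3: "spread K3 T3 W"
    unfolding K3_def K2_def K1_def T3_def T2_def T1_def
    by (metis sp K1_def K2_def s1.spread_subdivide s2.spread_subdivide s3.spread_subdivide)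
  have aW: "a \<notin> W" using sp s1.fresh_cycle_space by (auto simp: spread_def)
  have WV: "W \<subseteq> verts K" using sp gr unfolding spread_def cycle_space_def graph_def by blast
  have "a \<in> \<Union>T1" using uv by (auto simp: T1_def reroute_def)
  hence aT: "a \<in> \<Union>T3" using s2.Union_reroute[of T1] s3.Union_reroute[of T2]
    by (auto simp: T2_def T3_def)
  have nb: "x = b \<or> x = c" if "{a, x} \<in> edges K3" for x
    using that a b c V s1.fresh_edges[of "{a, x}"]
    by (auto simp: K3_def K2_def K1_def subdivide_def doubleton_eq_iff)
  have "\<not> adj K3 a x \<and> \<not> adj K3 x a" if "x \<in> insert a W" for x
  proof -
    have "x \<noteq> b" "x \<noteq> c" using that WV b c by auto
    thus ?thesis using nb unfolding adj_def by (metis insert_commute)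
  qed
  hence "spread K3 T3 (insert a W)" using sp3 aT unfolding spread_def by blast
  thus ?case using sub girth W aW by (metis card_insert_disjoint finite_insert)
qed

section \<open>Crossing copies\<close>

text \<open>\<open>P\<close>, \<open>Q\<close>, \<open>R\<close> will be the lines through three
  consecutive vertices of a cycle, \<open>A\<close>, \<open>B\<close>, \<open>D\<close> those
  through three remote vertices. Each of \<open>A\<close>, \<open>B\<close>, \<open>D\<close> has an
  element in \<open>Q\<close>, so its only other element lies in both \<open>P\<close> and
  \<open>R\<close>. The three elements obtained are not all equal, hence they fill both
  pairs.\<close>

lemma transversal_pairs_eq:
  fixes A :: "'i set"
  assumes AB: "finite A" "card A \<le> 2" "finite B" "card B \<le> 2" "finite D" "card D \<le> 2" "A \<inter> B \<inter> D = {}"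
    and PQ: "card P = 2" "card R = 2" "P \<inter> Q = {}" "Q \<inter> R = {}"
    and hit: "P \<inter> A \<noteq> {}" "P \<inter> B \<noteq> {}" "P \<inter> D \<noteq> {}"
      "Q \<inter> A \<noteq> {}" "Q \<inter> B \<noteq> {}" "Q \<inter> D \<noteq> {}" "R \<inter> A \<noteq> {}" "R \<inter> B \<noteq> {}" "R \<inter> D \<noteq> {}"
  shows "P = R"
proof -
  have single: "\<exists>s. P \<inter> X = {s} \<and> R \<inter> X = {s}"
    if X: "finite X" "card X \<le> 2" "P \<inter> X \<noteq> {}" "Q \<inter> X \<noteq> {}" "R \<inter> X \<noteq> {}" for X
  proof -
    obtain q where q: "q \<in> Q" "q \<in> X" using X by blast
    have "card (X - {q}) \<le> 1" using q X by simp
    hence u: "a = b" if "a \<in> X - {q}" "b \<in> X - {q}" for a b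
      using that X(1) card_le_Suc0_iff_eq[of "X - {q}"] by simp
    obtain s where s: "s \<in> P" "s \<in> X" using X by blast
    obtain t where t: "t \<in> R" "t \<in> X" using X by blast
    have sub: "P \<inter> X \<subseteq> X - {q}" "R \<inter> X \<subseteq> X - {q}" using q PQ by auto
    have "P \<inter> X = {s}" using u sub(1) s by blast
    moreover have "R \<inter> X = {s}" using u sub s t by blast
    ultimately show ?thesis by blast
  qed
  obtain a where a: "P \<inter> A = {a}" "R \<inter> A = {a}" using single AB hit by metis
  obtain b where b: "P \<inter> B = {b}" "R \<inter> B = {b}" using single AB hit by metis
  obtain d where d: "P \<inter> D = {d}" "R \<inter> D = {d}" using single AB hit by metis
  have sub: "{a, b, d} \<subseteq> P" "{a, b, d} \<subseteq> R" using a b d by auto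
  have "\<not> (a = b \<and> b = d)" using a b d AB(7) by auto
  hence "2 \<le> card {a, b, d}" by (auto simp: card_insert_if)
  hence "{a, b, d} = P" "{a, b, d} = R"
    using sub PQ(1,2) by (metis card.infinite card_seteq zero_neq_numeral)+
  thus ?thesis by simp
qed

section \<open>The host graph of pairwise crossing copies\<close>

locale crossing_copies =
  fixes K :: "nat graph" and w :: "nat \<Rightarrow> nat" and n :: nat
  assumes graph_K: "graph K"
    and inj_w: "inj_on w {..<n}"
    and w_verts: "i < n \<Longrightarrow> w i \<in> verts K"
    and w_nonadj: "i < n \<Longrightarrow> j < n \<Longrightarrow> \<not> adj K (w i) (w j)"
begin

text \<open>The vertex \<open>w j\<close> of line \<open>i\<close> is glued to the vertex \<open>w i\<close> of line \<open>j\<close>.\<close>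
definition place :: "nat \<Rightarrow> nat \<Rightarrow> nat" where
  "place i v = prod_encode
    (if v \<in> w ` {..<n}
     then (min i (inv_into {..<n} w v), w (max i (inv_into {..<n} w v)))
     else (i, v))"

definition line :: "nat \<Rightarrow> nat set" where
  "line i = place i ` verts K"

definition lines_of :: "nat \<Rightarrow> nat set" where
  "lines_of a = {i. i < n \<and> a \<in> line i}"

definition host :: "nat graph" where
  "host = (\<Union>i<n. line i,
    (\<Union>i<n. (`) (place i) ` edges K) \<union>
    {{a, b} |a b. a \<in> (\<Union>i<n. line i) \<and> b \<in> (\<Union>i<n. line i) \<and> lines_of a \<inter> lines_of b = {}})"

lemma w_eq_iff: "i < n \<Longrightarrow> j < n \<Longrightarrow> w i = w j \<longleftrightarrow> i = j"
  using inj_w by (auto dest: inj_onD)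

lemma place_w: "j < n \<Longrightarrow> place i (w j) = prod_encode (min i j, w (max i j))"
  using inj_w by (simp add: place_def)

lemma place_other: "v \<notin> w ` {..<n} \<Longrightarrow> place i v = prod_encode (i, v)"
  by (simp add: place_def)

text \<open>Minimum and maximum recover the unordered pair of lines, and the code of a vertex that
  is not glued has a second component that is none of the \<open>w k\<close>. The vertex
  \<open>w i\<close> of line \<open>i\<close> stays on line \<open>i\<close> only.\<close>

lemma place_eq_iff:
  assumes "i < n" "j < n"
  shows "place i v = place j v' \<longleftrightarrow> (i = j \<and> v = v') \<or> (i \<noteq> j \<and> v = w j \<and> v' = w i)"
proof -
  have img: "w (max p q) \<in> w ` {..<n}" if "p < n" "q < n" for p q
    using that by auto
  consider (a) k l where "k < n" "l < n" "v = w k" "v' = w l"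
    | (b) k where "k < n" "v = w k" "v' \<notin> w ` {..<n}"
    | (c) l where "l < n" "v' = w l" "v \<notin> w ` {..<n}"
    | (d) "v \<notin> w ` {..<n}" "v' \<notin> w ` {..<n}"
    by blast
  thus ?thesis
  proof cases
    case a
    have "place i v = place j v' \<longleftrightarrow> min i k = min j l \<and> max i k = max j l"
      using a assms by (simp add: place_w w_eq_iff)
    also have "\<dots> \<longleftrightarrow> (i = j \<and> k = l) \<or> (i \<noteq> j \<and> k = j \<and> l = i)"
      by (auto simp: min_def max_def)
    finally show ?thesis using a assms by (simp add: w_eq_iff)
  next
    case b
    have "place i v \<noteq> place j v'"
      using b img[of i k] assms by (auto simp: place_w place_other)
    thus ?thesis using b assms by auto
  next
    case c
    have "place i v \<noteq> place j v'"
      using c img[of j l] assms by (auto simp: place_w place_other)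
    thus ?thesis using c assms by auto
  next
    case d
    thus ?thesis using assms by (auto simp: place_other)
  qed
qed

lemma inj_place: "i < n \<Longrightarrow> inj_on (place i) A"
  by (auto intro: inj_onI simp: place_eq_iff)

lemma line_Int: 
  assumes "i < n" "j < n" "i \<noteq> j"
  shows "line i \<inter> line j = {place i (w j)}"
proof -
  have "place i (w j) = place j (w i)" using assms by (simp add: place_eq_iff)
  moreover have "place i (w j) \<in> line i" "place j (w i) \<in> line j"
    using assms w_verts by (auto simp: line_def)
  ultimately have "place i (w j) \<in> line i \<inter> line j" by simp
  moreover have "a = place i (w j)" if "a \<in> line i \<inter> line j" for a
    using that assms by (auto simp: line_def place_eq_iff)
  ultimately show ?thesis by blast
qed

lemma finite_lines_of [simp]: "finite (lines_of a)"
  by (simp add: lines_of_def)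

text \<open>Two further lines \<open>j\<close> and \<open>k\<close> through a vertex of line
  \<open>i\<close> would meet line \<open>i\<close> in that vertex, but they meet it in the copies
  of \<open>w j\<close> and \<open>w k\<close>, which differ.\<close>

lemma card_lines_of: "card (lines_of a) \<le> 2"
proof (rule ccontr)
  assume "\<not> ?thesis"
  hence "3 \<le> card (lines_of a)" by simp
  then obtain T where "T \<subseteq> lines_of a" "card T = 3" by (meson obtain_subset_with_card_n)
  then obtain i j k where ijk: "i \<in> lines_of a" "j \<in> lines_of a" "k \<in> lines_of a" "i \<noteq> j" "i \<noteq> k" "j \<noteq> k"
    by (auto simp: card_3_iff)
  hence "a \<in> line i \<inter> line j" "a \<in> line i \<inter> line k" "i < n" "j < n" "k < n"
    by (auto simp: lines_of_def)
  hence "place i (w j) = place i (w k)" using ijk line_Int by (metis singletonD)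
  thus False using ijk by (auto simp: lines_of_def place_eq_iff w_eq_iff)
qed

lemma common_lines_eq:
  assumes "{i, j} \<subseteq> lines_of a" "{i, j} \<subseteq> lines_of b" "i \<noteq> j"
  shows "a = b"
proof -
  have "a \<in> line i \<inter> line j" "b \<in> line i \<inter> line j" "i < n" "j < n"
    using assms by (auto simp: lines_of_def)
  thus ?thesis using line_Int[of i j] assms(3) by simp
qed

lemma verts_host: "verts host = (\<Union>i<n. line i)"
  by (simp add: host_def)

lemma edges_host: "e \<in> edges host \<longleftrightarrow> (\<exists>i<n. \<exists>d\<in>edges K. e = place i ` d) \<or>
    (\<exists>a\<in>verts host. \<exists>b\<in>verts host. e = {a, b} \<and> lines_of a \<inter> lines_of b = {})"
  unfolding host_def verts_edges_simps by blast

text \<open>Hence no vertex has a line set disjoint from itself, which keeps loops out of the join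
  edges of \<open>host\<close>.\<close>

lemma lines_of_nonempty: "a \<in> verts host \<Longrightarrow> lines_of a \<noteq> {}"
  by (auto simp: host_def lines_of_def)

lemma graph_host: "graph host"
  unfolding graph_def
proof (intro conjI ballI)
  have fin: "finite (verts K)" using graph_K by (simp add: graph_def)
  thus "finite (verts host)" by (simp add: host_def line_def)
  fix e assume "e \<in> edges host"
  then consider i d where "i < n" "d \<in> edges K" "e = place i ` d"
    | a b where "e = {a, b}" "a \<in> verts host" "b \<in> verts host" "lines_of a \<inter> lines_of b = {}"
    unfolding edges_host by blast
  hence "e \<subseteq> verts host \<and> card e = 2"
  proof cases
    case 1
    hence "d \<subseteq> verts K" "card d = 2" using graph_K by (auto simp: graph_def)
    thus ?thesis using 1 inj_place[of i d] by (auto simp: verts_host line_def card_image)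
  next
    case 2
    hence "a \<noteq> b" using lines_of_nonempty by auto
    thus ?thesis using 2 by auto
  qed
  thus "e \<subseteq> verts host" "card e = 2" by auto
qed

lemma adj_host_disjoint:
  "a \<in> verts host \<Longrightarrow> b \<in> verts host \<Longrightarrow> lines_of a \<inter> lines_of b = {} \<Longrightarrow> adj host a b"
  unfolding adj_def edges_host by blast

text \<open>No further edges arise inside a line: an edge of another line has two ends, but the two
  lines share only one vertex, and a join edge has ends without a common line.\<close>

lemma induced_line:
  assumes "i < n"
  shows "induced host (line i) = map_graph (place i) K"
proof -
  have "e \<in> (`) (place i) ` edges K" if e: "e \<in> edges host" "e \<subseteq> line i" for e
  proof -
    have c2: "card e = 2" using graph_host e by (auto simp: graph_def)
    from e(1) consider j d where "j < n" "d \<in> edges K" "e = place j ` d"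
      | a b where "e = {a, b}" "lines_of a \<inter> lines_of b = {}"
      unfolding edges_host by blast
    thus ?thesis
    proof cases
      case 1
      have "j = i"
      proof (rule ccontr)
        assume "j \<noteq> i"
        have "d \<subseteq> verts K" using 1 graph_K by (auto simp: graph_def)
        hence "e \<subseteq> line j" using 1 by (auto simp: line_def)
        hence "e \<subseteq> {place i (w j)}" using e(2) line_Int[OF assms 1(1)] \<open>j \<noteq> i\<close> by auto
        thus False using c2 card_mono[of "{place i (w j)}" e] by simp
      qed
      thus ?thesis using 1 by blast
    next
      case 2
      hence "i \<in> lines_of a \<inter> lines_of b" using e assms by (auto simp: lines_of_def)
      thus ?thesis using 2 by blast
    qed
  qed
  moreover have "(`) (place i) ` edges K \<subseteq> {e \<in> edges host. e \<subseteq> line i}"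
  proof -
    have "d \<subseteq> verts K" if "d \<in> edges K" for d using that graph_K by (auto simp: graph_def)
    thus ?thesis using assms by (auto simp: edges_host line_def)
  qed
  ultimately show ?thesis by (auto simp: induced_def map_graph_def line_def)
qed

text \<open>On a common line \<open>i\<close> both vertices are copies of some \<open>w j\<close>
  and \<open>w k\<close>. By \<open>induced_line\<close> an edge between them would come from an
  edge of \<open>K\<close>, against \<open>w_nonadj\<close>.\<close>

lemma crossing_nonadj:
  assumes "a \<in> verts host" "b \<in> verts host" "card (lines_of a) = 2" "card (lines_of b) = 2" "adj host a b"
  shows "lines_of a \<inter> lines_of b = {}"
proof (rule ccontr)
  assume "\<not> ?thesis"
  then obtain i where i: "i \<in> lines_of a" "i \<in> lines_of b" by blast
  have cross: "\<exists>j<n. c = place i (w j)" if c: "i \<in> lines_of c" "card (lines_of c) = 2" for c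
  proof -
    obtain p q where "lines_of c = {p, q}" "p \<noteq> q" using c(2) by (auto simp: card_2_iff)
    then obtain j where j: "j \<in> lines_of c" "j \<noteq> i" by auto
    hence "c \<in> line i \<inter> line j" "i < n" "j < n" using c(1) by (auto simp: lines_of_def)
    thus ?thesis using line_Int[of i j] j(2) by auto
  qed
  obtain j k where jk: "j < n" "k < n" "a = place i (w j)" "b = place i (w k)"
    using cross i assms(3,4) by metis
  have "i < n" using i by (simp add: lines_of_def)
  have "{a, b} \<subseteq> line i" using i by (simp add: lines_of_def)
  hence "{a, b} \<in> edges (induced host (line i))" using assms(5) by (simp add: adj_def induced_def)
  then obtain d where d: "d \<in> edges K" "place i ` d = place i ` {w j, w k}"
    using induced_line[OF \<open>i < n\<close>] jk by auto
  have "d = {w j, w k}" using iffD1[OF inj_image_eq_iff[OF inj_place[OF \<open>i < n\<close>]] d(2)] .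
  thus False using d(1) w_nonadj[OF jk(1,2)] by (simp add: adj_def)
qed

text \<open>Each covered vertex shares a line with each remote vertex, since otherwise the two would
  be joined. If the remote vertices have a common line, all covered vertices lie on it; if not,
  \<open>transversal_pairs_eq\<close> gives a contradiction.\<close>

lemma cycle_in_line:
  assumes X: "X \<subseteq> verts host" and S: "S \<in> cycle_space (induced host X)" "S \<noteq> {}"
    and R: "card R = 3" "\<forall>x\<in>R. remote (induced host X) S x"
  shows "\<exists>i<n. \<Union>S \<subseteq> line i"
proof -
  obtain x y z where R_eq: "R = {x, y, z}" and xyz: "x \<noteq> y" "x \<noteq> z" "y \<noteq> z"
    using R(1) by (auto simp: card_3_iff)
  have SX: "e \<subseteq> X" "e \<in> edges host" if "e \<in> S" for e
    using S that by (auto simp: cycle_space_def induced_def)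
  have meet: "lines_of c \<inter> lines_of r \<noteq> {}" if c: "c \<in> \<Union>S" and r: "r \<in> R" for c r
  proof
    assume "lines_of c \<inter> lines_of r = {}"
    moreover have rX: "r \<in> X" "c \<in> X" using r R(2) c SX by (auto simp: remote_def induced_def)
    ultimately have "adj host r c" using X by (intro adj_host_disjoint) auto
    hence "adj (induced host X) r c" using rX by (simp add: adj_def induced_def)
    thus False using r c R(2) by (auto simp: remote_def)
  qed
  show ?thesis
  proof (cases "lines_of x \<inter> lines_of y \<inter> lines_of z = {}")
    case False
    then obtain i where i: "i \<in> lines_of x" "i \<in> lines_of y" "i \<in> lines_of z" by blast
    have "c \<in> line i" if c: "c \<in> \<Union>S" for c
    proof (rule ccontr)
      assume "c \<notin> line i"
      hence ni: "i \<notin> lines_of c" by (simp add: lines_of_def)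
      obtain j k l where jkl: "j \<in> lines_of c" "j \<in> lines_of x" "k \<in> lines_of c" "k \<in> lines_of y"
        "l \<in> lines_of c" "l \<in> lines_of z"
        using meet[OF c] R_eq by (metis disjoint_iff insertCI)
      \<comment> \<open>Two remote vertices have only the line \<open>i\<close> in common, so a
        vertex off line \<open>i\<close> needs a different line for each of the three.\<close>
      have "j \<noteq> k" "j \<noteq> l" "k \<noteq> l"
        using jkl i ni xyz common_lines_eq[of i] by (metis empty_subsetI insert_subset)+
      hence "card {j, k, l} = 3" by simp
      moreover have "{j, k, l} \<subseteq> lines_of c" using jkl by simp
      ultimately show False using card_lines_of[of c] card_mono[OF finite_lines_of, of "{j, k, l}" c] by linarith
    qed
    thus ?thesis using i by (auto simp: lines_of_def)
  next
    case True
    \<comment> \<open>If \<open>c\<close> were on a single line, that line would contain all three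
      remote vertices, against \<open>True\<close>.\<close>
    have two: "card (lines_of c) = 2" if c: "c \<in> \<Union>S" for c
    proof (rule ccontr)
      assume "card (lines_of c) \<noteq> 2"
      hence "card (lines_of c) \<le> 1" using card_lines_of[of c] by simp
      hence u: "\<And>i j. i \<in> lines_of c \<Longrightarrow> j \<in> lines_of c \<Longrightarrow> i = j"
        by (simp add: card_le_Suc0_iff_eq)
      obtain j k l where jkl: "j \<in> lines_of c" "j \<in> lines_of x" "k \<in> lines_of c" "k \<in> lines_of y"
        "l \<in> lines_of c" "l \<in> lines_of z"
        using meet[OF c] R_eq by (metis disjoint_iff insertCI)
      hence "j = k" "j = l" using u by auto
      thus False using True jkl by blast
    qed
    obtain e where e: "e \<in> S" using S(2) by blast
    then obtain c1 c2 where c12: "e = {c1, c2}" "c1 \<noteq> c2"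
      using graph_edgeE[OF graph_host SX(2)] by metis
    \<comment> \<open>Even degree at \<open>c2\<close> yields a second edge there, hence three
      consecutive vertices; by \<open>crossing_nonadj\<close> neighbours among them have disjoint
      line sets.\<close>
    have "even (card {d \<in> S. c2 \<in> d})" using S by (simp add: cycle_space_def edeg_def)
    moreover have "e \<in> {d \<in> S. c2 \<in> d}" using e c12 by simp
    ultimately have "{d \<in> S. c2 \<in> d} \<noteq> {e}" by (metis card_1_singleton_iff odd_one One_nat_def)
    then obtain e' where e': "e' \<in> S" "c2 \<in> e'" "e' \<noteq> e" using e c12 by auto
    then obtain c3 where c3: "e' = {c2, c3}"
      using graph_edgeE[OF graph_host SX(2)[OF e'(1)]] by (metis insert_iff insert_commute singletonD)
    have c13: "c1 \<noteq> c3" using c3 c12 e' by (auto simp: insert_commute)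
    have cS: "c1 \<in> \<Union>S" "c2 \<in> \<Union>S" "c3 \<in> \<Union>S" using e e' c12 c3 by auto
    have cV: "c1 \<in> verts host" "c2 \<in> verts host" "c3 \<in> verts host" using cS SX X by blast+
    have adj: "adj host c1 c2" "adj host c2 c3" using SX e e' c12 c3 by (auto simp: adj_def)
    have "lines_of c1 = lines_of c3"
    proof (rule transversal_pairs_eq[of "lines_of x" "lines_of y" "lines_of z" _ _ "lines_of c2"])
      show "lines_of c1 \<inter> lines_of c2 = {}" "lines_of c2 \<inter> lines_of c3 = {}"
        using adj two cS cV crossing_nonadj by auto
    qed (use True two cS meet R_eq card_lines_of in auto)
    moreover obtain i j where "lines_of c1 = {i, j}" "i \<noteq> j"
      using two[OF cS(1)] by (auto simp: card_2_iff)
    ultimately have "c1 = c3" using common_lines_eq[of i j c1 c3] by simp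
    thus ?thesis using c13 by simp
  qed
qed

end

section \<open>Induced subdivisions of \<open>H\<close> in the host graph\<close>

context crossing_copies
begin

lemma induced_subdiv_line:
  assumes "graph H" "subdivision_of H K" "i < n"
  shows "induced_subdiv H host (line i)"
  using assms subdivision_of_map_graph[OF assms(2,1) inj_place[OF assms(3)]]
  by (auto simp: induced_subdiv_def induced_line verts_host)

text \<open>Remote vertices and girth first trap \<open>X\<close> in one line. The cycle space of
  \<open>F\<close> is then contained in that of the line and has the same size, so it contains the
  copy of \<open>T\<close>, which covers all \<open>place i (w j)\<close>.\<close>

lemma induced_subdiv_contains_crossings:
  assumes H: "graph H" and sub: "subdivision_of H K"
    and deg: "\<And>v. edeg (edges H) v \<le> d" "2 \<le> d"
    and girth: "girth_ge ((d + 3)\<^sup>2) K"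
    and T: "T \<in> cycle_space K" "w ` {..<n} \<subseteq> \<Union>T"
    and S0: "S0 \<in> cycle_space H" "S0 \<noteq> {}" and R0: "card R0 = 3" "\<forall>x\<in>R0. remote H S0 x"
    and X: "induced_subdiv H host X"
  shows "\<exists>i<n. place i ` w ` {..<n} \<subseteq> X"
proof -
  define F where "F = induced host X"
  have XV: "X \<subseteq> verts host" and F: "subdivision_of H F"
    using X by (auto simp: induced_subdiv_def F_def)
  have grF: "graph F" using subdivision_of_graph F H by blast
  obtain S R where S: "S \<in> cycle_space F" "S \<noteq> {}" and R: "card R = 3" "\<forall>x\<in>R. remote F S x"
    using subdivision_of_remote[OF F H S0 R0(2)] R0(1) by auto
  obtain i where i: "i < n" "\<Union>S \<subseteq> line i"
    using cycle_in_line[OF XV] S R unfolding F_def by blast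
  have injK: "inj_on (place i) (verts K)" using inj_place i by blast
  have SF: "S \<subseteq> edges F" and ev: "\<forall>v. even (edeg S v)" using S by (auto simp: cycle_space_def)
  have "S \<subseteq> edges (induced host (line i))" using SF i(2) by (auto simp: F_def induced_def)
  hence "S \<in> cycle_space (map_graph (place i) K)"
    using ev induced_line[OF i(1)] by (simp add: cycle_space_def)
  then obtain S' where S': "S' \<in> cycle_space K" "S = (`) (place i) ` S'"
    using cycle_space_map_graph[OF graph_K injK] by auto
  have "inj_on ((`) (place i)) S'"
    using inj_on_image_image(1)[OF graph_K injK] S' by (auto simp: cycle_space_def intro: inj_on_subset)
  hence "(d + 3)\<^sup>2 \<le> card S"
    using girth S' S(2) by (auto simp: girth_ge_def card_image)
  \<comment> \<open>Edges are encoded by ordered pairs of covered vertices, so at least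
    \<open>(d + 3)\<^sup>2\<close> edges need at least \<open>d + 3\<close> vertices.\<close>
  also have "card S \<le> (card (\<Union>S))\<^sup>2"
  proof -
    have "\<Union>S \<subseteq> verts F" using SF grF by (auto simp: graph_def)
    hence fin: "finite (\<Union>S)" using grF by (auto simp: graph_def intro: finite_subset)
    have "S \<subseteq> (\<lambda>(a, b). {a, b}) ` (\<Union>S \<times> \<Union>S)"
    proof
      fix e assume e: "e \<in> S"
      then obtain a b where "e = {a, b}" using graph_edgeE[OF grF] SF by (metis subsetD)
      thus "e \<in> (\<lambda>(a, b). {a, b}) ` (\<Union>S \<times> \<Union>S)" using e by (intro image_eqI[of _ _ "(a, b)"]) auto
    qed
    hence "card S \<le> card (\<Union>S \<times> \<Union>S)" using fin by (meson finite_SigmaI surj_card_le)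
    thus ?thesis by (simp add: card_cartesian_product power2_eq_square)
  qed
  finally have big: "d + 3 \<le> card (\<Union>S)" by (simp add: power2_nat_le_eq_le)
  have "X \<subseteq> line i"
  proof
    fix v assume v: "v \<in> X"
    show "v \<in> line i"
    proof (rule ccontr)
      assume nv: "v \<notin> line i"
      \<comment> \<open>Line \<open>i\<close> meets each of the at most two lines of
        \<open>v\<close> once, so \<open>B\<close> has at most two elements. The other covered
        vertices, at least \<open>d + 1\<close>, are all joined to \<open>v\<close>, more than the
        degree bound allows.\<close>
      define B where "B = {c \<in> \<Union>S. lines_of c \<inter> lines_of v \<noteq> {}}"
      have "B \<subseteq> (\<lambda>j. place i (w j)) ` lines_of v"
      proof
        fix c assume "c \<in> B"
        then obtain j where j: "c \<in> \<Union>S" "j \<in> lines_of c" "j \<in> lines_of v" by (auto simp: B_def)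
        have "j \<noteq> i" "j < n" "c \<in> line j" using j nv by (auto simp: lines_of_def)
        hence "c = place i (w j)" using line_Int[of i j] i j(1) by auto
        thus "c \<in> (\<lambda>j. place i (w j)) ` lines_of v" using j(3) by blast
      qed
      hence B: "finite B" "card B \<le> card (lines_of v)"
        by (auto intro: finite_subset surj_card_le)
      have "(\<lambda>c. {v, c}) ` (\<Union>S - B) \<subseteq> {e \<in> edges F. v \<in> e}"
      proof
        fix e assume "e \<in> (\<lambda>c. {v, c}) ` (\<Union>S - B)"
        then obtain c where c: "c \<in> \<Union>S" "c \<notin> B" "e = {v, c}" by auto
        have cX: "c \<in> X" using c SF by (auto simp: F_def induced_def)
        have "lines_of v \<inter> lines_of c = {}" using c by (auto simp: B_def)
        hence "adj host v c" using adj_host_disjoint XV v cX by blast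
        thus "e \<in> {e \<in> edges F. v \<in> e}" using c cX v by (simp add: F_def induced_def adj_def)
      qed
      moreover have "inj_on (\<lambda>c. {v, c}) (\<Union>S - B)" by (rule inj_onI) (auto simp: doubleton_eq_iff)
      moreover have "finite {e \<in> edges F. v \<in> e}" using graph_finite_edges[OF grF] by simp
      ultimately have "card (\<Union>S - B) \<le> edeg (edges F) v"
        unfolding edeg_def by (metis card_inj_on_le)
      also have "\<dots> \<le> d" using edeg_subdivision_of_le[OF F H deg] .
      finally have "card (\<Union>S - B) \<le> d" .
      moreover have "card (\<Union>S) - card B \<le> card (\<Union>S - B)" using B(1) by (rule diff_card_le_card_Diff)
      ultimately show False using big B card_lines_of[of v] by linarith
    qed
  qed
  hence "edges F \<subseteq> edges (induced host (line i))" by (auto simp: F_def induced_def)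
  hence "cycle_space F \<subseteq> cycle_space (map_graph (place i) K)"
    using induced_line[OF i(1)] by (auto simp: cycle_space_def)
  \<comment> \<open>Both \<open>F\<close> and \<open>K\<close> are subdivisions of \<open>H\<close>,
    so the inclusion is between finite sets of the same size.\<close>
  moreover have "card (cycle_space F) = card (cycle_space (map_graph (place i) K))"
    using card_cycle_space_subdivision_of[OF F H] card_cycle_space_subdivision_of[OF sub H]
      card_cycle_space_map_graph[OF graph_K injK] by simp
  ultimately have "cycle_space F = cycle_space (map_graph (place i) K)"
    using finite_cycle_space[OF graph_map_graph[OF graph_K injK]] card_subset_eq by blast
  hence "(`) (place i) ` T \<in> cycle_space F"
    using T(1) cycle_space_map_graph[OF graph_K injK] by auto
  hence "\<Union>((`) (place i) ` T) \<subseteq> X" by (auto simp: cycle_space_def F_def induced_def)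
  moreover have "place i ` w ` {..<n} \<subseteq> \<Union>((`) (place i) ` T)"
    using image_mono[OF T(2), of "place i"] by (simp add: image_Union)
  ultimately show ?thesis using i(1) by (meson subset_trans)
qed

text \<open>Double counting: \<open>n\<close> lines have to be met and each vertex meets at most
  two.\<close>

lemma hitting_set_lower_bound:
  assumes "finite A" "\<And>i. i < n \<Longrightarrow> line i \<inter> A \<noteq> {}"
  shows "n \<le> 2 * card A"
proof -
  have "{..<n} \<subseteq> (\<Union>a\<in>A. lines_of a)" using assms(2) by (fastforce simp: lines_of_def)
  hence "n \<le> card (\<Union>a\<in>A. lines_of a)"
    using assms(1) by (metis card_lessThan card_mono finite_UN_I finite_lines_of)
  also have "\<dots> \<le> (\<Sum>a\<in>A. card (lines_of a))" using assms(1) by (rule card_UN_le)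
  also have "\<dots> \<le> (\<Sum>a\<in>A. 2)" by (rule sum_mono) (rule card_lines_of)
  finally show ?thesis by simp
qed

end

section \<open>Failure of the property already for two disjoint subdivisions\<close>

theorem mainTheorem6:
  fixes H :: "'b graph" and C :: "'b list" and x y z :: 'b
  assumes "graph H"
    and "is_cycle H C"
    and "x \<in> verts H" "y \<in> verts H" "z \<in> verts H"
    and "x \<noteq> y" "x \<noteq> z" "y \<noteq> z"
    and "\<forall>c\<in>set C. \<not> adj H x c \<and> \<not> adj H y c \<and> \<not> adj H z c"
  shows "\<not> induced_EP H"
proof
  assume "induced_EP H"
  then obtain f :: "nat \<Rightarrow> real" where f: "\<And>(G :: nat graph) (k :: nat). graph G \<Longrightarrow> k > 0 \<Longrightarrow>
      (\<exists>Xs :: nat \<Rightarrow> nat set. (\<forall>i<k. induced_subdiv H G (Xs i)) \<and>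
           (\<forall>i<k. \<forall>j<k. i \<noteq> j \<longrightarrow> Xs i \<inter> Xs j = {}))
    \<or> (\<exists>S. S \<subseteq> verts G \<and> real (card S) \<le> f k \<and>
           (\<forall>X. induced_subdiv H G X \<longrightarrow> X \<inter> S \<noteq> {}))"
    unfolding induced_EP_def by blast
  obtain S0 where S0: "S0 \<in> cycle_space H" "S0 \<noteq> {}" "\<Union>S0 = set C"
    using is_cycle_cycle_space[OF assms(2)] by blast
  \<comment> \<open>Each vertex of \<open>C\<close> has a neighbour on \<open>C\<close>, so
    \<open>x\<close>, \<open>y\<close> and \<open>z\<close> lie off the cycle, as
    \<open>remote\<close> demands.\<close>
  have neighbour: "\<exists>c\<in>set C. adj H v c" if v: "v \<in> set C" for v
  proof -
    obtain i where i: "i < length C" "v = C ! i" using v by (metis in_set_conv_nth)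
    hence "adj H v (C ! ((i + 1) mod length C))" using assms(2) by (auto simp: is_cycle_def)
    moreover have "(i + 1) mod length C < length C" using i(1) by (intro mod_less_divisor) linarith
    ultimately show ?thesis using nth_mem by blast
  qed
  have R0: "\<forall>v\<in>{x, y, z}. remote H S0 v"
    using neighbour assms(3-5,9) S0(3) unfolding remote_def by blast
  have card_R0: "card {x, y, z} = 3" using assms(6-8) by simp
  \<comment> \<open>The number of edges is a crude degree bound; the maximum with 2 covers the
    vertices created by subdivision.\<close>
  define d where "d = max 2 (card (edges H))"
  have deg: "edeg (edges H) v \<le> d" for v
  proof -
    have "edeg (edges H) v \<le> card (edges H)"
      unfolding edeg_def using graph_finite_edges[OF assms(1)] by (intro card_mono) auto
    thus ?thesis by (simp add: d_def)
  qed
  \<comment> \<open>Moving \<open>H\<close> into \<open>nat\<close> provides fresh vertices for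
    subdivisions and matches the host graphs in \<open>induced_EP\<close>.\<close>
  obtain h :: "'b \<Rightarrow> nat" where h: "inj_on h (verts H)"
    using assms(1) finite_imp_inj_to_nat_seg unfolding graph_def by metis
  have "subdivision_of H (map_graph h H)"
    using subdivision_of.base graph_map_graph isomorphic_map_graph h assms(1) by blast
  then obtain K0 :: "nat graph" where K0: "subdivision_of H K0" "girth_ge ((d + 3)\<^sup>2) K0"
    using ex_subdivision_girth_ge assms(1) by blast
  obtain T0 where T0: "T0 \<in> cycle_space K0" "T0 \<noteq> {}"
    using subdivision_of_remote[OF K0(1) assms(1) S0(1,2) R0] by blast
  \<comment> \<open>Half of \<open>n\<close> must exceed \<open>f 2\<close>; \<open>nat\<close>
    takes care of a negative \<open>f 2\<close>.\<close>
  define n where "n = Suc (nat \<lceil>2 * f 2\<rceil>)"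
  obtain K :: "nat graph" and T W where K: "subdivision_of H K" "girth_ge ((d + 3)\<^sup>2) K"
    and sp: "spread K T W" and W: "finite W" "card W = n"
    using ex_subdivision_spread[OF K0(1) assms(1) K0(2) T0] by blast
  obtain w where w: "bij_betw w {..<n} W"
    using ex_bij_betw_nat_finite[OF W(1)] W(2) by (auto simp: atLeast0LessThan)
  have wW: "w i \<in> W" if "i < n" for i using w that by (auto simp: bij_betw_def)
  have grK: "graph K" using subdivision_of_graph K(1) assms(1) by blast
  interpret crossing_copies K w n
  proof
    show "w i \<in> verts K" if "i < n" for i
      using wW[OF that] sp grK unfolding spread_def cycle_space_def graph_def by blast
  qed (use grK w wW sp in \<open>auto simp: bij_betw_def spread_def\<close>)
  have cross: "\<exists>i<n. place i ` w ` {..<n} \<subseteq> X" if "induced_subdiv H host X" for X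
  proof (rule induced_subdiv_contains_crossings[OF assms(1) K(1) deg _ K(2) _ _ S0(1,2) card_R0 R0 that])
    show "T \<in> cycle_space K" "w ` {..<n} \<subseteq> \<Union>T"
      using sp w by (auto simp: spread_def bij_betw_def)
  qed (simp add: d_def)
  consider Xs :: "nat \<Rightarrow> nat set" where "\<forall>i<2. induced_subdiv H host (Xs i)"
      "\<forall>i<2. \<forall>j<2. i \<noteq> j \<longrightarrow> Xs i \<inter> Xs j = {}"
    | A where "A \<subseteq> verts host" "real (card A) \<le> f 2"
      "\<forall>X. induced_subdiv H host X \<longrightarrow> X \<inter> A \<noteq> {}"
    using f[OF graph_host, of 2] by auto
  thus False
  proof cases
    case 1
    obtain i j where ij: "i < n" "place i ` w ` {..<n} \<subseteq> Xs 0" "j < n" "place j ` w ` {..<n} \<subseteq> Xs 1"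
      using cross[of "Xs 0"] cross[of "Xs 1"] 1(1) by auto
    \<comment> \<open>This is where lines \<open>i\<close> and \<open>j\<close> cross; for
      \<open>i = j\<close> both sides are the copy of \<open>w i\<close>, so the case of one common
      line is included.\<close>
    have "place i (w j) = place j (w i)" using ij by (auto simp: place_eq_iff)
    moreover have "place i (w j) \<in> Xs 0" "place j (w i) \<in> Xs 1" using ij by blast+
    ultimately have "place i (w j) \<in> Xs 0 \<inter> Xs 1" by simp
    thus False using 1(2) by auto
  next
    case 2
    have "finite A" using 2(1) graph_host by (auto simp: graph_def intro: finite_subset)
    hence "n \<le> 2 * card A"
      using hitting_set_lower_bound 2(3) induced_subdiv_line[OF assms(1) K(1)] by blast
    hence "real n \<le> 2 * f 2" using 2(2) by linarith
    thus False unfolding n_def by linarith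
  qed
qed

end
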